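(* Let $(A,V)$ and $(B,W)$ be permutation groups. Then $A\wr B\in DGR$ if and only if both $A\in DGR$ and $B\in DGR$.
   Context: Permutation groups are considered up to permutation isomorphism and act on sets with more than one element. A colored directed graph is a pair $(V,E)$ with $E$ a function from the ordered pairs of distinct vertices to a set of colors; its automorphisms are color-preserving permutations of $V$. $DGR$ is the class of permutation groups that are (permutation isomorphic to) the automorphism group of some colored directed graph. The (imprimitive) wreath product $A\wr B$ is the permutation group on $V\times W$ consisting of all permutations $\gamma$ for which there are $\alpha_w\in A$ ($w\in W$) and $\beta\in B$ with $(v,w)\gamma=(v\alpha_w,w\beta)$ for all $(v,w)\in V\times W$. *)

theory Defs
  imports "HOL-Algebra.Bij"
begin

definition permutation_group :: "('a \<Rightarrow> 'a) set \<Rightarrow> 'a set \<Rightarrow> bool" where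
  "permutation_group A V \<longleftrightarrow> subgroup A (BijGroup V) \<and> (\<exists>x\<in>V. \<exists>y\<in>V. x \<noteq> y)"

definition permutation_isomorphic ::
  "('a \<Rightarrow> 'a) set \<Rightarrow> 'a set \<Rightarrow> ('b \<Rightarrow> 'b) set \<Rightarrow> 'b set \<Rightarrow> bool" where
  "permutation_isomorphic A V B W \<longleftrightarrow>
     (\<exists>\<phi> \<psi>. bij_betw \<phi> V W
        \<and> \<psi> \<in> iso (BijGroup V\<lparr>carrier := A\<rparr>) (BijGroup W\<lparr>carrier := B\<rparr>)
        \<and> (\<forall>f\<in>A. \<forall>v\<in>V. \<phi> (f v) = \<psi> f (\<phi> v)))"

text \<open>
  A colored directed graph is a pair of a vertex set \<open>V\<close> and a function \<open>E\<close> giving the colors of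
  the ordered pairs of distinct elements of \<open>V\<close>; all other values of \<open>E\<close> are irrelevant.
\<close>

definition digraph_automorphisms :: "'a set \<Rightarrow> ('a \<times> 'a \<Rightarrow> 'c) \<Rightarrow> ('a \<Rightarrow> 'a) set" where
  "digraph_automorphisms V E =
     {f \<in> Bij V. \<forall>x\<in>V. \<forall>y\<in>V. x \<noteq> y \<longrightarrow> E (f x, f y) = E (x, y)}"

text \<open>
  The types of vertices and colors cannot be quantified over inside the definition. Vertices are
  taken from the type \<open>'a\<close> and colors from \<open>'a \<times> 'a\<close>; there are never more colors in use than pairs
  of vertices, so this is no restriction, as shown by \<open>in_DGR\<close> below.
\<close>

definition DGR :: "(('a \<Rightarrow> 'a) set \<times> 'a set) set" where
  "DGR = {(A, V). permutation_group A V \<and>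
            (\<exists>(V' :: 'a set) (E :: 'a \<times> 'a \<Rightarrow> 'a \<times> 'a).
               permutation_isomorphic A V (digraph_automorphisms V' E) V')}"

definition wreath ::
  "('a \<Rightarrow> 'a) set \<Rightarrow> 'a set \<Rightarrow> ('b \<Rightarrow> 'b) set \<Rightarrow> 'b set \<Rightarrow> ('a \<times> 'b \<Rightarrow> 'a \<times> 'b) set" where
  "wreath A V B W =
     {\<gamma> \<in> Bij (V \<times> W). \<exists>\<alpha>. (\<forall>w\<in>W. \<alpha> w \<in> A) \<and>
        (\<exists>\<beta>\<in>B. \<forall>v\<in>V. \<forall>w\<in>W. \<gamma> (v, w) = (\<alpha> w v, \<beta> w))}"

lemma in_DGR:
  fixes A :: "('a \<Rightarrow> 'a) set" and V' :: "'b set" and E :: "'b \<times> 'b \<Rightarrow> 'c"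
  assumes A: "permutation_group A V"
    and iso: "permutation_isomorphic A V (digraph_automorphisms V' E) V'"
  shows "(A, V) \<in> DGR"
proof -
  obtain \<phi> \<psi> where \<phi>: "bij_betw \<phi> V V'"
    and \<psi>: "\<psi> \<in> iso (BijGroup V\<lparr>carrier := A\<rparr>)
                 (BijGroup V'\<lparr>carrier := digraph_automorphisms V' E\<rparr>)"
    and eq: "\<And>f v. f \<in> A \<Longrightarrow> v \<in> V \<Longrightarrow> \<phi> (f v) = \<psi> f (\<phi> v)"
    using iso unfolding permutation_isomorphic_def by blast
  have im: "\<psi> ` A = digraph_automorphisms V' E"
    using \<psi> by (simp add: iso_def bij_betw_def)
  have AB: "A \<subseteq> Bij V"
    using A subgroup.subset unfolding permutation_group_def BijGroup_def by fastforce
  define c where "c = (\<lambda>(x, y). E (\<phi> x, \<phi> y))"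
  define E' where "E' p = (SOME q. c q = c p)" for p :: "'a \<times> 'a"
  have E'c: "c (E' p) = c p" for p
    unfolding E'_def by (rule someI) (rule refl)
  have E': "E' p = E' q \<longleftrightarrow> c p = c q" for p q
  proof
    assume "E' p = E' q" then show "c p = c q" using E'c[of p] E'c[of q] by simp
  next
    assume "c p = c q" then show "E' p = E' q" by (simp only: E'_def)
  qed
  have inV: "\<phi> v \<in> V'" if "v \<in> V" for v using \<phi> that by (auto simp: bij_betw_def)
  have inj: "x = y" if "\<phi> x = \<phi> y" "x \<in> V" "y \<in> V" for x y
    using \<phi> that by (auto simp: bij_betw_def inj_on_def)
  have "A = digraph_automorphisms V E'"
  proof
    show "A \<subseteq> digraph_automorphisms V E'"
    proof
      fix f assume f: "f \<in> A"
      then have "\<psi> f \<in> digraph_automorphisms V' E" using im by auto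
      then have "c (f x, f y) = c (x, y)" if "x \<in> V" "y \<in> V" "x \<noteq> y" for x y
        using that eq[OF f] inV inj[of x y] unfolding c_def digraph_automorphisms_def by fastforce
      then show "f \<in> digraph_automorphisms V E'"
        using f AB by (auto simp: digraph_automorphisms_def E')
    qed
  next
    show "digraph_automorphisms V E' \<subseteq> A"
    proof
      fix f assume f: "f \<in> digraph_automorphisms V E'"
      then have fB: "f \<in> Bij V" by (simp add: digraph_automorphisms_def)
      define g where "g = (\<lambda>y\<in>V'. \<phi> (f (inv_into V \<phi> y)))"
      have "bij_betw (\<phi> \<circ> (f \<circ> inv_into V \<phi>)) V' V'"
        using \<phi> fB by (intro bij_betw_trans[of _ V' V] bij_betw_inv_into) (auto simp: Bij_def)
      then have "bij_betw g V' V'"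
        by (rule bij_betw_cong[THEN iffD1, rotated]) (simp add: g_def)
      then have gB: "g \<in> Bij V'" by (simp add: Bij_def g_def)
      have g\<phi>: "g (\<phi> v) = \<phi> (f v)" if "v \<in> V" for v
        using that \<phi> inV by (simp add: g_def bij_betw_inv_into_left)
      have "E (g x, g y) = E (x, y)" if xy: "x \<in> V'" "y \<in> V'" "x \<noteq> y" for x y
      proof -
        obtain a b where ab: "x = \<phi> a" "y = \<phi> b" "a \<in> V" "b \<in> V"
          using xy \<phi> by (auto simp: bij_betw_def)
        then have "c (f a, f b) = c (a, b)"
          using f xy E' unfolding digraph_automorphisms_def by fastforce
        then show ?thesis using ab g\<phi> by (simp add: c_def)
      qed
      then have "g \<in> \<psi> ` A" using gB im by (simp add: digraph_automorphisms_def)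
      then obtain f0 where f0: "f0 \<in> A" "g = \<psi> f0" by auto
      have "f = f0"
      proof (rule extensionalityI[of _ V])
        show "f \<in> extensional V" "f0 \<in> extensional V"
          using fB f0 AB by (auto simp: Bij_def)
        fix v assume v: "v \<in> V"
        then have "f v \<in> V" "f0 v \<in> V"
          using fB f0 AB Bij_imp_funcset by blast+
        then show "f v = f0 v" using inj g\<phi>[OF v] eq[OF f0(1) v] f0(2) by simp
      qed
      then show "f \<in> A" using f0 by simp
    qed
  qed
  moreover have "permutation_isomorphic A V A V"
    unfolding permutation_isomorphic_def
    by (rule exI[of _ id], rule exI[of _ id]) (auto simp: iso_def hom_def)
  ultimately show ?thesis
    using A unfolding DGR_def by auto
qed

end

theory Submission
  imports Defs
begin

text \<open>
  Membership in \<^term>\<open>DGR\<close> is 2-closedness: a permutation that agrees on every pair of distinct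
  points with some element of the group lies in the group. The orbits on pairs serve as colors.
  A permutation of \<open>V \<times> W\<close> that agrees on pairs with elements of the wreath product preserves
  fibers \<open>V \<times> {w}\<close>, so it splits into a permutation of \<open>W\<close> locally in \<open>B\<close> and permutations of \<open>V\<close>
  locally in \<open>A\<close>. Conversely, a permutation locally in \<open>A\<close> or \<open>B\<close> yields one of \<open>V \<times> W\<close> that
  is locally in the wreath product, by acting trivially on the other coordinate.
\<close>

text \<open>Says that \<open>f\<close> lies in the 2-closure of \<open>A\<close>, when
  \<open>f\<close> is a permutation of \<open>V\<close>. Pairs are distinct because graphs color
  only such pairs; single points are recovered in \<open>locally_in_point\<close>.\<close>

definition locally_in :: "('a \<Rightarrow> 'a) \<Rightarrow> ('a \<Rightarrow> 'a) set \<Rightarrow> 'a set \<Rightarrow> bool" where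
  "locally_in f A V \<longleftrightarrow> (\<forall>x\<in>V. \<forall>y\<in>V. x \<noteq> y \<longrightarrow> (\<exists>a\<in>A. a x = f x \<and> a y = f y))"

section \<open>Permutations of a set and groups of them\<close>

lemma BijI:
  assumes "f \<in> extensional V" "f ` V = V" "inj_on f V"
  shows "f \<in> Bij V"
  using assms by (auto simp: Bij_def bij_betw_def)

lemma Bij_mem: "f \<in> Bij V \<Longrightarrow> x \<in> V \<Longrightarrow> f x \<in> V"
  using Bij_imp_funcset by blast

lemma Bij_inj: "f \<in> Bij V \<Longrightarrow> x \<in> V \<Longrightarrow> y \<in> V \<Longrightarrow> f x = f y \<longleftrightarrow> x = y"
  by (auto simp: Bij_def bij_betw_def inj_on_def)

lemma Bij_eqI: "f \<in> Bij V \<Longrightarrow> g \<in> Bij V \<Longrightarrow> (\<And>x. x \<in> V \<Longrightarrow> f x = g x) \<Longrightarrow> f = g"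
  using Bij_imp_extensional extensionalityI by blast

lemma Bij_inv_into_right:
  assumes "f \<in> Bij V" "x \<in> V"
  shows "inv_into V f x \<in> V" "f (inv_into V f x) = x"
  using assms by (auto simp: Bij_def bij_betw_def inv_into_into f_inv_into_f)

text \<open>Replaces the operations of \<open>BijGroup V\<close>, which are meaningful only on
  \<open>Bij V\<close>, by explicit composition and inversion, so that later closure arguments can
  work with functions directly.\<close>

lemma permutation_group_iff:
  "permutation_group A V \<longleftrightarrow> A \<subseteq> Bij V \<and> (\<lambda>x\<in>V. x) \<in> A \<and>
     (\<forall>f\<in>A. \<forall>g\<in>A. compose V f g \<in> A) \<and> (\<forall>f\<in>A. restrict (inv_into V f) V \<in> A) \<and>
     (\<exists>x\<in>V. \<exists>y\<in>V. x \<noteq> y)"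
proof -
  have "subgroup A (BijGroup V) \<longleftrightarrow> A \<subseteq> Bij V \<and> (\<lambda>x\<in>V. x) \<in> A \<and>
     (\<forall>f\<in>A. \<forall>g\<in>A. compose V f g \<in> A) \<and> (\<forall>f\<in>A. restrict (inv_into V f) V \<in> A)"
    (is "?L \<longleftrightarrow> ?R")
  proof
    assume L: ?L
    then have "A \<subseteq> Bij V" using subgroup.subset by (fastforce simp: BijGroup_def)
    moreover have "restrict (inv_into V f) V \<in> A" if "f \<in> A" for f
      using subgroup.m_inv_closed[OF L that] inv_BijGroup[of f V] that calculation by auto
    moreover have "compose V f g \<in> A" if "f \<in> A" "g \<in> A" for f g
    proof -
      have "f \<in> Bij V" "g \<in> Bij V" using that calculation by auto
      then show ?thesis
        using subgroup.m_closed[OF L that] by (simp add: BijGroup_def)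
    qed
    moreover have "(\<lambda>x\<in>V. x) \<in> A"
      using subgroup.one_closed[OF L] by (simp add: BijGroup_def)
    ultimately show ?R by blast
  next
    assume R: ?R
    show ?L
    proof (rule group.subgroupI[OF group_BijGroup])
      show "A \<subseteq> carrier (BijGroup V)" using R by (simp add: BijGroup_def)
      show "A \<noteq> {}" using R by blast
      show "inv\<^bsub>BijGroup V\<^esub> f \<in> A" if "f \<in> A" for f
        using R that inv_BijGroup[of f V] by auto
      show "f \<otimes>\<^bsub>BijGroup V\<^esub> g \<in> A" if "f \<in> A" "g \<in> A" for f g
      proof -
        have "f \<in> Bij V" "g \<in> Bij V" using that R by auto
        then show ?thesis using R that by (simp add: BijGroup_def)
      qed
    qed
  qed
  then show ?thesis by (auto simp: permutation_group_def)
qed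

section \<open>Color automorphism groups and 2-closed groups\<close>

text \<open>Preserving colors is a condition on one pair at a time. On each pair \<open>f\<close>
  acts like some element of \<open>A\<close>, that is, like a color automorphism after transport
  along \<phi>, so the transported \<open>f\<close> preserves all colors.\<close>

lemma DGR_imp_locally_closed:
  assumes "(A, V) \<in> DGR" and f: "f \<in> Bij V" and loc: "locally_in f A V"
  shows "f \<in> A"
proof -
  obtain V' :: "'a set" and E :: "'a \<times> 'a \<Rightarrow> 'a \<times> 'a" and \<phi> \<psi>
    where A: "permutation_group A V" and \<phi>: "bij_betw \<phi> V V'"
      and \<psi>: "\<psi> \<in> iso (BijGroup V\<lparr>carrier := A\<rparr>)
                   (BijGroup V'\<lparr>carrier := digraph_automorphisms V' E\<rparr>)"
      and eq: "\<And>f v. f \<in> A \<Longrightarrow> v \<in> V \<Longrightarrow> \<phi> (f v) = \<psi> f (\<phi> v)"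
    using assms(1) unfolding DGR_def permutation_isomorphic_def by blast
  have im: "\<psi> ` A = digraph_automorphisms V' E"
    using \<psi> by (simp add: iso_def bij_betw_def)
  have AB: "A \<subseteq> Bij V" using A by (simp add: permutation_group_iff)
  \<comment> \<open>The conjugate of \<open>f\<close> by \<phi>. It has to be built by hand, since
    \<psi> is controlled only on \<open>A\<close> and \<open>f\<close> is not yet known to lie
    there.\<close>
  define g where "g = (\<lambda>y\<in>V'. \<phi> (f (inv_into V \<phi> y)))"
  have "bij_betw (\<phi> \<circ> (f \<circ> inv_into V \<phi>)) V' V'"
    using \<phi> f by (intro bij_betw_trans[of _ V' V] bij_betw_inv_into) (auto simp: Bij_def)
  then have "bij_betw g V' V'"
    by (rule bij_betw_cong[THEN iffD1, rotated]) (simp add: g_def)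
  then have gB: "g \<in> Bij V'" by (simp add: Bij_def g_def)
  have g\<phi>: "g (\<phi> v) = \<phi> (f v)" if "v \<in> V" for v
    using that \<phi> by (auto simp: g_def bij_betw_inv_into_left bij_betw_def)
  have "E (g x, g y) = E (x, y)" if xy: "x \<in> V'" "y \<in> V'" "x \<noteq> y" for x y
  proof -
    obtain v w where vw: "x = \<phi> v" "y = \<phi> w" "v \<in> V" "w \<in> V"
      using xy \<phi> by (auto simp: bij_betw_def)
    then obtain a where a: "a \<in> A" "a v = f v" "a w = f w"
      using loc xy unfolding locally_in_def by metis
    then have "E (\<psi> a x, \<psi> a y) = E (x, y)"
      using im xy unfolding digraph_automorphisms_def by blast
    then show ?thesis using eq[OF a(1)] a vw g\<phi> by metis
  qed
  then have "g \<in> \<psi> ` A" using gB im by (simp add: digraph_automorphisms_def)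
  then obtain a where a: "a \<in> A" "g = \<psi> a" by auto
  have "f = a"
  proof (rule Bij_eqI[OF f])
    show aB: "a \<in> Bij V" using a AB by blast
    fix v assume v: "v \<in> V"
    have "\<phi> (f v) = \<phi> (a v)" using g\<phi>[OF v] eq[OF a(1) v] a(2) by simp
    then show "f v = a v"
      by (rule inj_onD[OF bij_betw_imp_inj_on[OF \<phi>] _ Bij_mem[OF f v] Bij_mem[OF aB v]])
  qed
  then show ?thesis using a by simp
qed

text \<open>Color each pair by its orbit under \<open>A\<close>. A permutation that preserves these
  colors sends each pair into its own orbit, so it is locally in \<open>A\<close>, and closedness
  applies.\<close>

lemma locally_closed_imp_DGR:
  assumes A: "permutation_group A V"
    and closed: "\<And>f. f \<in> Bij V \<Longrightarrow> locally_in f A V \<Longrightarrow> f \<in> A"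
  shows "(A, V) \<in> DGR"
proof -
  have AB: "A \<subseteq> Bij V" and id: "(\<lambda>x\<in>V. x) \<in> A"
    and comp: "\<And>f g. f \<in> A \<Longrightarrow> g \<in> A \<Longrightarrow> compose V f g \<in> A"
    and inv: "\<And>f. f \<in> A \<Longrightarrow> restrict (inv_into V f) V \<in> A"
    using A by (auto simp: permutation_group_iff)
  \<comment> \<open>The orbit of the pair \<open>p\<close> under \<open>A\<close>. The colors are
    sets of pairs; \<open>in_DGR\<close> accepts any type of colors and recodes them as
    pairs.\<close>
  define E where "E p = {(a (fst p), a (snd p)) | a. a \<in> A}" for p
  have "digraph_automorphisms V E = A"
  proof (intro equalityI subsetI)
    fix f assume f: "f \<in> digraph_automorphisms V E"
    have "locally_in f A V"
      unfolding locally_in_def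
    proof (intro ballI impI)
      fix x y assume xy: "x \<in> V" "y \<in> V" "x \<noteq> y"
      have fV: "f x \<in> V" "f y \<in> V" using f xy Bij_mem by (auto simp: digraph_automorphisms_def)
      \<comment> \<open>A pair lies in its own orbit by the identity of the group. This identity is
        restricted to \<open>V\<close>, hence the need for \<open>fV\<close>.\<close>
      then have "(f x, f y) \<in> E (f x, f y)"
        unfolding E_def using id by (auto intro!: exI[of _ "\<lambda>x\<in>V. x"])
      moreover have "E (f x, f y) = E (x, y)" using f xy by (auto simp: digraph_automorphisms_def)
      ultimately have "(f x, f y) \<in> E (x, y)" by simp
      then show "\<exists>a\<in>A. a x = f x \<and> a y = f y" unfolding E_def by force
    qed
    then show "f \<in> A" using closed f by (auto simp: digraph_automorphisms_def)
  next
    fix f assume f: "f \<in> A"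
    then have fB: "f \<in> Bij V" using AB by blast
    \<comment> \<open>A pair and its image under \<open>f\<close> have the same orbit: composing a
      witness with \<open>f\<close> gives one inclusion, composing it with the inverse of
      \<open>f\<close> gives the other.\<close>
    have "E (f x, f y) = E (x, y)" if xy: "x \<in> V" "y \<in> V" for x y
    proof (intro equalityI subsetI)
      fix p assume "p \<in> E (f x, f y)"
      then obtain a where "a \<in> A" "p = (a (f x), a (f y))" by (auto simp: E_def)
      then show "p \<in> E (x, y)"
        using comp[OF _ f] xy unfolding E_def
        by (auto intro!: exI[of _ "compose V a f"] simp: compose_eq)
    next
      fix p assume "p \<in> E (x, y)"
      then obtain a where "a \<in> A" "p = (a x, a y)" by (auto simp: E_def)
      moreover have "inv_into V f (f z) = z" if "z \<in> V" for z
        using fB that by (auto simp: Bij_def intro: bij_betw_inv_into_left)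
      ultimately show "p \<in> E (f x, f y)"
        using comp[OF _ inv[OF f]] xy fB Bij_mem[OF fB] unfolding E_def
        by (auto intro!: exI[of _ "compose V a (restrict (inv_into V f) V)"] simp: compose_eq)
    qed
    then show "f \<in> digraph_automorphisms V E" using fB by (simp add: digraph_automorphisms_def)
  qed
  moreover have "permutation_isomorphic A V A V"
    unfolding permutation_isomorphic_def
    by (rule exI[of _ id], rule exI[of _ id]) (auto simp: iso_def hom_def)
  ultimately show ?thesis using in_DGR[OF A, of V E] by simp
qed

section \<open>The wreath product as a permutation group\<close>

lemma wreathE:
  assumes "\<gamma> \<in> wreath A V B W"
  obtains \<alpha> \<beta> where "\<And>w. w \<in> W \<Longrightarrow> \<alpha> w \<in> A" "\<beta> \<in> B"
    "\<And>v w. v \<in> V \<Longrightarrow> w \<in> W \<Longrightarrow> \<gamma> (v, w) = (\<alpha> w v, \<beta> w)"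
  using assms unfolding wreath_def by blast

lemma wreathI:
  assumes "\<gamma> \<in> Bij (V \<times> W)" "\<And>w. w \<in> W \<Longrightarrow> \<alpha> w \<in> A" "\<beta> \<in> B"
    "\<And>v w. v \<in> V \<Longrightarrow> w \<in> W \<Longrightarrow> \<gamma> (v, w) = (\<alpha> w v, \<beta> w)"
  shows "\<gamma> \<in> wreath A V B W"
  using assms unfolding wreath_def by blast

text \<open>The shape of every element of a wreath product, with the default value outside
  \<open>V \<times> W\<close> that \<open>Bij\<close> demands. Nothing ties \<alpha> and \<beta> to
  groups, so it also serves for permutations whose membership is still open.\<close>

definition wreath_perm :: "'a set \<Rightarrow> 'b set \<Rightarrow> ('b \<Rightarrow> 'a \<Rightarrow> 'a) \<Rightarrow> ('b \<Rightarrow> 'b) \<Rightarrow> 'a \<times> 'b \<Rightarrow> 'a \<times> 'b" where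
  "wreath_perm V W \<alpha> \<beta> = (\<lambda>(v, w)\<in>V \<times> W. (\<alpha> w v, \<beta> w))"

lemma wreath_perm_apply: "v \<in> V \<Longrightarrow> w \<in> W \<Longrightarrow> wreath_perm V W \<alpha> \<beta> (v, w) = (\<alpha> w v, \<beta> w)"
  by (simp add: wreath_perm_def)

lemma wreath_perm_Bij:
  assumes \<alpha>: "\<And>w. w \<in> W \<Longrightarrow> \<alpha> w \<in> Bij V" and \<beta>: "\<beta> \<in> Bij W"
  shows "wreath_perm V W \<alpha> \<beta> \<in> Bij (V \<times> W)"
proof (rule BijI)
  show "wreath_perm V W \<alpha> \<beta> \<in> extensional (V \<times> W)" by (simp add: wreath_perm_def)
  show "inj_on (wreath_perm V W \<alpha> \<beta>) (V \<times> W)"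
    using Bij_inj[OF \<alpha>] Bij_inj[OF \<beta>] by (auto simp: inj_on_def wreath_perm_apply)
  show "wreath_perm V W \<alpha> \<beta> ` (V \<times> W) = V \<times> W"
  proof (intro equalityI subsetI)
    fix p assume "p \<in> wreath_perm V W \<alpha> \<beta> ` (V \<times> W)"
    then show "p \<in> V \<times> W"
      using Bij_mem[OF \<alpha>] Bij_mem[OF \<beta>] by (auto simp: wreath_perm_apply)
  next
    fix p assume "p \<in> V \<times> W"
    then obtain v w where p: "p = (v, w)" "v \<in> V" "w \<in> W" by blast
    define w' where "w' = inv_into W \<beta> w"
    have w': "w' \<in> W" "\<beta> w' = w" using Bij_inv_into_right[OF \<beta> p(3)] by (auto simp: w'_def)
    \<comment> \<open>The preimage is found by undoing \<beta> first: only then is it known which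
      fiber \<open>w'\<close> the point came from, and so which \<alpha> is to be inverted.\<close>
    have "p = wreath_perm V W \<alpha> \<beta> (inv_into V (\<alpha> w') v, w')"
      using p w' Bij_inv_into_right[OF \<alpha>[OF w'(1)] p(2)] by (simp add: wreath_perm_apply)
    then show "p \<in> wreath_perm V W \<alpha> \<beta> ` (V \<times> W)"
      using p w' Bij_inv_into_right[OF \<alpha>[OF w'(1)] p(2)] by blast
  qed
qed

lemma permutation_group_wreath:
  assumes A: "permutation_group A V" and B: "permutation_group B W"
  shows "permutation_group (wreath A V B W) (V \<times> W)"
proof -
  have AB: "A \<subseteq> Bij V" "(\<lambda>x\<in>V. x) \<in> A"
    "\<And>f g. f \<in> A \<Longrightarrow> g \<in> A \<Longrightarrow> compose V f g \<in> A"
    "\<And>f. f \<in> A \<Longrightarrow> restrict (inv_into V f) V \<in> A"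
    and BB: "B \<subseteq> Bij W" "(\<lambda>x\<in>W. x) \<in> B"
    "\<And>f g. f \<in> B \<Longrightarrow> g \<in> B \<Longrightarrow> compose W f g \<in> B"
    "\<And>f. f \<in> B \<Longrightarrow> restrict (inv_into W f) W \<in> B"
    using A B by (auto simp: permutation_group_iff)
  have sub: "wreath A V B W \<subseteq> Bij (V \<times> W)" by (auto simp: wreath_def)
  have "(\<lambda>x\<in>V \<times> W. x) \<in> wreath A V B W"
    by (rule wreathI[where \<alpha> = "\<lambda>_. \<lambda>x\<in>V. x" and \<beta> = "\<lambda>x\<in>W. x"])
      (use AB BB id_Bij in auto)
  moreover have "compose (V \<times> W) f g \<in> wreath A V B W"
    if f: "f \<in> wreath A V B W" and g: "g \<in> wreath A V B W" for f g
  proof -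
    obtain \<alpha> \<beta> where \<alpha>: "\<And>w. w \<in> W \<Longrightarrow> \<alpha> w \<in> A" "\<beta> \<in> B"
      "\<And>v w. v \<in> V \<Longrightarrow> w \<in> W \<Longrightarrow> f (v, w) = (\<alpha> w v, \<beta> w)" using f wreathE by metis
    obtain \<alpha>' \<beta>' where \<alpha>': "\<And>w. w \<in> W \<Longrightarrow> \<alpha>' w \<in> A" "\<beta>' \<in> B"
      "\<And>v w. v \<in> V \<Longrightarrow> w \<in> W \<Longrightarrow> g (v, w) = (\<alpha>' w v, \<beta>' w)" using g wreathE by metis
    have mem: "\<beta>' w \<in> W" "\<And>v. v \<in> V \<Longrightarrow> \<alpha>' w v \<in> V" if "w \<in> W" for w
      using Bij_mem[of \<beta>' W w] Bij_mem[of "\<alpha>' w" V] \<alpha>'(1,2) that AB(1) BB(1) by (auto dest: subsetD)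
    show ?thesis
    \<comment> \<open>Here \<open>g\<close> acts first and moves the fiber of \<open>w\<close> to
      that of \<open>\<beta>' w\<close>, so \<open>f\<close> acts there with the component of index
      \<open>\<beta>' w\<close>.\<close>
    proof (rule wreathI[where \<alpha> = "\<lambda>w. compose V (\<alpha> (\<beta>' w)) (\<alpha>' w)" and \<beta> = "compose W \<beta> \<beta>'"])
      show "compose (V \<times> W) f g \<in> Bij (V \<times> W)" using f g sub compose_Bij by blast
    qed (use \<alpha> \<alpha>' mem AB BB in \<open>auto simp: compose_eq\<close>)
  qed
  moreover have "restrict (inv_into (V \<times> W) f) (V \<times> W) \<in> wreath A V B W"
    if f: "f \<in> wreath A V B W" for f
  proof -
    obtain \<alpha> \<beta> where \<alpha>: "\<And>w. w \<in> W \<Longrightarrow> \<alpha> w \<in> A" "\<beta> \<in> B"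
      "\<And>v w. v \<in> V \<Longrightarrow> w \<in> W \<Longrightarrow> f (v, w) = (\<alpha> w v, \<beta> w)" using f wreathE by metis
    have fB: "f \<in> Bij (V \<times> W)" using f sub by blast
    define \<beta>' where "\<beta>' = restrict (inv_into W \<beta>) W"
    \<comment> \<open>The inverse takes the fiber of \<open>w\<close> back to that of
      \<open>\<beta>' w\<close>, so it must undo the component of \<open>f\<close> with that
      index.\<close>
    define \<alpha>' where "\<alpha>' w = restrict (inv_into V (\<alpha> (\<beta>' w))) V" for w
    have \<beta>': "\<beta>' w \<in> W" "\<beta> (\<beta>' w) = w" if "w \<in> W" for w
      using Bij_inv_into_right[of \<beta> W w] \<alpha>(2) BB(1) that by (auto simp: \<beta>'_def)
    have \<alpha>': "\<alpha>' w v \<in> V" "\<alpha> (\<beta>' w) (\<alpha>' w v) = v" if "w \<in> W" "v \<in> V" for v w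
      using Bij_inv_into_right[of "\<alpha> (\<beta>' w)" V v] \<alpha>(1)[OF \<beta>'(1)] AB(1) that by (auto simp: \<alpha>'_def)
    show ?thesis
    proof (rule wreathI[where \<alpha> = \<alpha>' and \<beta> = \<beta>'])
      show "restrict (inv_into (V \<times> W) f) (V \<times> W) \<in> Bij (V \<times> W)"
        using fB by (rule restrict_inv_into_Bij)
      show "\<alpha>' w \<in> A" if "w \<in> W" for w using \<alpha>(1)[OF \<beta>'(1)[OF that]] AB(4) by (simp add: \<alpha>'_def)
      show "\<beta>' \<in> B" using \<alpha>(2) BB(4) by (simp add: \<beta>'_def)
      fix v w assume vw: "v \<in> V" "w \<in> W"
      then have "f (\<alpha>' w v, \<beta>' w) = (v, w)" using \<alpha>(3) \<beta>' \<alpha>' by simp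
      moreover have "inj_on f (V \<times> W)" using fB by (simp add: Bij_def bij_betw_def)
      ultimately have "inv_into (V \<times> W) f (v, w) = (\<alpha>' w v, \<beta>' w)"
        using vw \<beta>' \<alpha>' by (intro inv_into_f_eq) auto
      then show "restrict (inv_into (V \<times> W) f) (V \<times> W) (v, w) = (\<alpha>' w v, \<beta>' w)"
        using vw by simp
    qed
  qed
  moreover have "\<exists>x\<in>V \<times> W. \<exists>y\<in>V \<times> W. x \<noteq> y"
    using A B by (fastforce simp: permutation_group_iff)
  ultimately show ?thesis using sub by (simp add: permutation_group_iff)
qed

section \<open>Local membership in the wreath product\<close>

text \<open>\<open>locally_in\<close> speaks of distinct pairs only; the second point comes from
  \<open>V\<close> having more than one element.\<close>

lemma locally_in_point:
  assumes "locally_in f A V" "permutation_group A V" "x \<in> V"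
  obtains a where "a \<in> A" "a x = f x"
proof -
  obtain y where "y \<in> V" "x \<noteq> y" using assms(2) by (metis permutation_group_def)
  then show ?thesis using assms that unfolding locally_in_def by blast
qed

text \<open>On two distinct points \<open>f\<close> agrees with a single element of
  \<open>A\<close>, and that element separates them.\<close>

lemma locally_in_inj_on:
  assumes "locally_in f A V" "A \<subseteq> Bij V"
  shows "inj_on f V"
proof (rule inj_onI, rule ccontr)
  fix x y assume xy: "x \<in> V" "y \<in> V" "f x = f y" "x \<noteq> y"
  then obtain a where "a \<in> A" "a x = f x" "a y = f y"
    using assms(1) unfolding locally_in_def by blast
  then show False using xy Bij_inj[of a V x y] assms(2) by auto
qed

text \<open>Two points of one fiber are moved by \<gamma> as by an element of the wreath product, so
  they stay in a common fiber. Hence \<gamma> splits into a map \<beta> of fibers and maps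
  \<open>\<alpha> w\<close> inside them, and both inherit local membership.\<close>

lemma locally_in_wreath:
  assumes A: "permutation_group A V" and B: "permutation_group B W"
    and \<gamma>: "\<gamma> \<in> Bij (V \<times> W)" and loc: "locally_in \<gamma> (wreath A V B W) (V \<times> W)"
  obtains \<alpha> \<beta> where "\<And>w. w \<in> W \<Longrightarrow> \<alpha> w \<in> Bij V \<and> locally_in (\<alpha> w) A V"
    "\<beta> \<in> Bij W" "locally_in \<beta> B W"
    "\<And>v w. v \<in> V \<Longrightarrow> w \<in> W \<Longrightarrow> \<gamma> (v, w) = (\<alpha> w v, \<beta> w)"
proof -
  have AB: "A \<subseteq> Bij V" "B \<subseteq> Bij W" using A B by (auto simp: permutation_group_iff)
  obtain v0 where v0: "v0 \<in> V" using A by (auto simp: permutation_group_def)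
  \<comment> \<open>\<beta> is read off at the base point \<open>v0\<close>; \<open>fib\<close>
    shows that any other point of \<open>V\<close> gives the same value.\<close>
  define \<beta> where "\<beta> = (\<lambda>w\<in>W. snd (\<gamma> (v0, w)))"
  define \<alpha> where "\<alpha> w = (\<lambda>v\<in>V. fst (\<gamma> (v, w)))" for w
  have fib: "snd (\<gamma> (v, w)) = snd (\<gamma> (v', w))" if vw: "v \<in> V" "v' \<in> V" "w \<in> W" for v v' w
  proof (cases "v = v'")
    case False
    then obtain \<delta> where \<delta>: "\<delta> \<in> wreath A V B W" "\<delta> (v, w) = \<gamma> (v, w)" "\<delta> (v', w) = \<gamma> (v', w)"
      using loc vw unfolding locally_in_def by blast
    then show ?thesis using vw by (metis wreathE snd_conv)
  qed simp
  have eq: "\<gamma> (v, w) = (\<alpha> w v, \<beta> w)" if "v \<in> V" "w \<in> W" for v w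
    using that fib[of v v0 w] v0 by (simp add: \<alpha>_def \<beta>_def prod_eq_iff)
  have mem: "\<alpha> w v \<in> V \<and> \<beta> w \<in> W" if "v \<in> V" "w \<in> W" for v w
    using Bij_mem[OF \<gamma>, of "(v, w)"] eq that by simp
  \<comment> \<open>Surjectivity of the components must come from that of \<gamma>. Local membership
    gives only injectivity: on an infinite set, every injection into itself is locally in the full
    symmetric group.\<close>
  have surj: "\<exists>v'\<in>V. \<exists>w'\<in>W. \<alpha> w' v' = v \<and> \<beta> w' = w" if "v \<in> V" "w \<in> W" for v w
  proof -
    have "(v, w) \<in> \<gamma> ` (V \<times> W)" using \<gamma> that by (simp add: Bij_def bij_betw_def)
    then show ?thesis using eq by fastforce
  qed
  have \<beta>loc: "locally_in \<beta> B W"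
    unfolding locally_in_def
  proof (intro ballI impI)
    fix x y assume xy: "x \<in> W" "y \<in> W" "x \<noteq> y"
    then obtain \<delta> where \<delta>: "\<delta> \<in> wreath A V B W" "\<delta> (v0, x) = \<gamma> (v0, x)" "\<delta> (v0, y) = \<gamma> (v0, y)"
      using loc v0 unfolding locally_in_def by blast
    obtain a b where "b \<in> B" "\<And>v w. v \<in> V \<Longrightarrow> w \<in> W \<Longrightarrow> \<delta> (v, w) = (a w v, b w)"
      using \<delta>(1) wreathE by metis
    then show "\<exists>b\<in>B. b x = \<beta> x \<and> b y = \<beta> y"
      using \<delta> eq v0 xy by (intro bexI[of _ b]) auto
  qed
  have \<beta>inj: "inj_on \<beta> W" by (rule locally_in_inj_on[OF \<beta>loc AB(2)])
  have "\<beta> ` W = W" using mem[OF v0] surj[OF v0] by blast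
  then have \<beta>B: "\<beta> \<in> Bij W" using \<beta>inj by (intro BijI) (auto simp: \<beta>_def)
  have "\<alpha> w \<in> Bij V \<and> locally_in (\<alpha> w) A V" if w: "w \<in> W" for w
  proof
    show l: "locally_in (\<alpha> w) A V"
      unfolding locally_in_def
    proof (intro ballI impI)
      fix x y assume xy: "x \<in> V" "y \<in> V" "x \<noteq> y"
      then obtain \<delta> where \<delta>: "\<delta> \<in> wreath A V B W" "\<delta> (x, w) = \<gamma> (x, w)" "\<delta> (y, w) = \<gamma> (y, w)"
        using loc w unfolding locally_in_def by blast
      obtain a b where "\<And>w. w \<in> W \<Longrightarrow> a w \<in> A"
        "\<And>v w. v \<in> V \<Longrightarrow> w \<in> W \<Longrightarrow> \<delta> (v, w) = (a w v, b w)"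
        using \<delta>(1) wreathE by metis
      then show "\<exists>a\<in>A. a x = \<alpha> w x \<and> a y = \<alpha> w y"
        using \<delta> eq w xy by (intro bexI[of _ "a w"]) auto
    qed
    \<comment> \<open>The preimage of \<open>(v, \<beta> w)\<close> under \<gamma> lies in a fiber
      that \<beta> sends to \<open>\<beta> w\<close>; as \<beta> is injective, this is the fiber of
      \<open>w\<close>.\<close>
    have "\<exists>v'\<in>V. \<alpha> w v' = v" if "v \<in> V" for v
      using surj[of v "\<beta> w"] mem[OF v0 w] \<beta>inj that w by (metis inj_onD)
    then have "\<alpha> w ` V = V" using mem[OF _ w] by blast
    then show "\<alpha> w \<in> Bij V"
      using locally_in_inj_on[OF l AB(1)] by (intro BijI) (auto simp: \<alpha>_def)
  qed
  then show ?thesis using that[of \<alpha> \<beta>] \<beta>B \<beta>loc eq by blast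
qed

text \<open>An element of the wreath product can act on different fibers independently. So two
  points in different fibers constrain its components in \<open>A\<close> one point at a time, and
  two points in one fiber constrain its component in \<open>B\<close> at one point only.\<close>

lemma wreath_perm_locally_in:
  assumes A: "permutation_group A V" and B: "permutation_group B W"
    and f: "locally_in f A V" and g: "locally_in g B W"
  shows "locally_in (wreath_perm V W (\<lambda>_. f) g) (wreath A V B W) (V \<times> W)"
  unfolding locally_in_def
proof (intro ballI impI)
  have AB: "A \<subseteq> Bij V" "B \<subseteq> Bij W" using A B by (auto simp: permutation_group_iff)
  fix p q assume "p \<in> V \<times> W" "q \<in> V \<times> W" "p \<noteq> q"
  then obtain v w v' w' where pq: "p = (v, w)" "q = (v', w')" "v \<in> V" "v' \<in> V" "w \<in> W" "w' \<in> W"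
    "v \<noteq> v' \<or> w \<noteq> w'" by auto
  have "\<exists>\<alpha> b. (\<forall>u\<in>W. \<alpha> u \<in> A) \<and> b \<in> B \<and> \<alpha> w v = f v \<and> \<alpha> w' v' = f v' \<and> b w = g w \<and> b w' = g w'"
  proof (cases "w = w'")
    case True
    then obtain a where "a \<in> A" "a v = f v" "a v' = f v'"
      using f pq unfolding locally_in_def by blast
    moreover obtain b where "b \<in> B" "b w = g w" using locally_in_point[OF g B pq(5)] .
    ultimately show ?thesis using True by (intro exI[of _ "\<lambda>_. a"] exI[of _ b]) auto
  next
    case False
    then obtain b where "b \<in> B" "b w = g w" "b w' = g w'"
      using g pq unfolding locally_in_def by blast
    moreover obtain a where "a \<in> A" "a v = f v" using locally_in_point[OF f A pq(3)] .
    moreover obtain a' where "a' \<in> A" "a' v' = f v'" using locally_in_point[OF f A pq(4)] .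
    ultimately show ?thesis
      \<comment> \<open>Fiber \<open>w\<close> gets \<open>a\<close>, fiber \<open>w'\<close> gets
        \<open>a'\<close>; on the remaining fibers any element of \<open>A\<close> would do.\<close>
      using False by (intro exI[of _ "\<lambda>u. if u = w then a else a'"] exI[of _ b]) auto
  qed
  then obtain \<alpha> b where *: "\<And>u. u \<in> W \<Longrightarrow> \<alpha> u \<in> A" "b \<in> B" "\<alpha> w v = f v" "\<alpha> w' v' = f v'"
    "b w = g w" "b w' = g w'" by blast
  have "wreath_perm V W \<alpha> b \<in> wreath A V B W"
  proof (rule wreathI)
    show "wreath_perm V W \<alpha> b \<in> Bij (V \<times> W)"
      using * AB by (intro wreath_perm_Bij) auto
  qed (use * in \<open>auto simp: wreath_perm_apply\<close>)
  then show "\<exists>a\<in>wreath A V B W. a p = wreath_perm V W (\<lambda>_. f) g p \<and>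
      a q = wreath_perm V W (\<lambda>_. f) g q"
    using * pq by (intro bexI[of _ "wreath_perm V W \<alpha> b"]) (auto simp: wreath_perm_apply)
qed

text \<open>The decomposition of a wreath product element is unique on \<open>V\<close> and
  \<open>W\<close> as both are nonempty, and extensionality turns agreement there into equality of
  functions.\<close>

lemma wreath_perm_in_wreathD:
  assumes A: "permutation_group A V" and B: "permutation_group B W"
    and f: "f \<in> Bij V" and g: "g \<in> Bij W"
    and "wreath_perm V W (\<lambda>_. f) g \<in> wreath A V B W"
  shows "f \<in> A" "g \<in> B"
proof -
  have AB: "A \<subseteq> Bij V" "B \<subseteq> Bij W" using A B by (auto simp: permutation_group_iff)
  obtain v w where vw: "v \<in> V" "w \<in> W" using A B by (auto simp: permutation_group_def)
  obtain \<alpha> \<beta> where *: "\<And>w. w \<in> W \<Longrightarrow> \<alpha> w \<in> A" "\<beta> \<in> B"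
    "\<And>v w. v \<in> V \<Longrightarrow> w \<in> W \<Longrightarrow> wreath_perm V W (\<lambda>_. f) g (v, w) = (\<alpha> w v, \<beta> w)"
    using assms(5) wreathE by metis
  have "f = \<alpha> w"
    using *(1)[of w] *(3)[of _ w] vw AB by (intro Bij_eqI[OF f]) (auto simp: wreath_perm_apply)
  then show "f \<in> A" using *(1) vw by simp
  have "g = \<beta>"
    using *(2) *(3)[of v] vw AB by (intro Bij_eqI[OF g]) (auto simp: wreath_perm_apply)
  then show "g \<in> B" using *(2) by simp
qed

theorem theorem2p10:
  fixes A :: "('a \<Rightarrow> 'a) set" and V :: "'a set"
    and B :: "('b \<Rightarrow> 'b) set" and W :: "'b set"
  assumes "permutation_group A V" and "permutation_group B W"
  shows "(wreath A V B W, V \<times> W) \<in> DGR \<longleftrightarrow> (A, V) \<in> DGR \<and> (B, W) \<in> DGR"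
proof
  assume wr: "(wreath A V B W, V \<times> W) \<in> DGR"
  \<comment> \<open>Both factors are treated at once; setting \<open>g\<close> or \<open>f\<close>
    to the identity then isolates one of them.\<close>
  have mem: "f \<in> A \<and> g \<in> B"
    if "f \<in> Bij V" "locally_in f A V" "g \<in> Bij W" "locally_in g B W" for f g
  proof -
    have "wreath_perm V W (\<lambda>_. f) g \<in> wreath A V B W"
      using that by (intro DGR_imp_locally_closed[OF wr] wreath_perm_Bij
        wreath_perm_locally_in assms)
    then show ?thesis using wreath_perm_in_wreathD[OF assms] that by blast
  qed
  have "(\<lambda>x\<in>V. x) \<in> A" "(\<lambda>x\<in>W. x) \<in> B"
    using assms by (auto simp: permutation_group_iff)
  then have id: "locally_in (\<lambda>x\<in>V. x) A V" "locally_in (\<lambda>x\<in>W. x) B W"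
    by (auto simp only: locally_in_def)
  have "(A, V) \<in> DGR"
    by (rule locally_closed_imp_DGR[OF assms(1)]) (rule mem[OF _ _ id_Bij id(2), THEN conjunct1])
  moreover have "(B, W) \<in> DGR"
    by (rule locally_closed_imp_DGR[OF assms(2)]) (rule mem[OF id_Bij id(1), THEN conjunct2])
  ultimately show "(A, V) \<in> DGR \<and> (B, W) \<in> DGR" ..
next
  assume AB: "(A, V) \<in> DGR \<and> (B, W) \<in> DGR"
  show "(wreath A V B W, V \<times> W) \<in> DGR"
  proof (rule locally_closed_imp_DGR[OF permutation_group_wreath[OF assms]])
    fix \<gamma> assume \<gamma>: "\<gamma> \<in> Bij (V \<times> W)" and loc: "locally_in \<gamma> (wreath A V B W) (V \<times> W)"
    obtain \<alpha> \<beta> where *: "\<And>w. w \<in> W \<Longrightarrow> \<alpha> w \<in> Bij V \<and> locally_in (\<alpha> w) A V"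
      "\<beta> \<in> Bij W" "locally_in \<beta> B W"
      "\<And>v w. v \<in> V \<Longrightarrow> w \<in> W \<Longrightarrow> \<gamma> (v, w) = (\<alpha> w v, \<beta> w)"
      by (rule locally_in_wreath[OF assms \<gamma> loc]) blast
    show "\<gamma> \<in> wreath A V B W"
      \<comment> \<open>The components of \<gamma> are locally in \<open>A\<close> and
        \<open>B\<close>, hence in them because both groups are in \<open>DGR\<close>.\<close>
      using * AB by (intro wreathI[OF \<gamma>, of \<alpha> A \<beta>]) (blast intro: DGR_imp_locally_closed)+
  qed
qed

end
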